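(* Let $p\ge 2$ and $n\ge 2$ be integers, let $E\in\mathbb{Z}[X]$ be a monic polynomial of degree $n$, and let $\gamma$ be an integer with $0<\gamma<p$ and $E(\gamma)\equiv 0\pmod p$. Let $\mathfrak{L}\subseteq\mathbb{Z}^n$ be the lattice generated by the rows $A_0=(p,0,\dots,0)$ and $A_i=-\gamma e_{i-1}+e_i$ for $1\le i\le n-1$. Let $\mathbf{B}=(b_{i,j})_{0\le i,j\le n-1}$ be an $n\times n$ matrix whose rows $B_0,\dots,B_{n-1}$ form a basis of $\mathfrak{L}$, and let $\|\mathbf{B}\|_1=\max_j\sum_{i=0}^{n-1}|b_{i,j}|$. If $\rho>\frac12\|\mathbf{B}\|_1$, then $(p,n,\gamma,\rho)_E$ is a Polynomial Modular Number System.
   Context: A Polynomial Modular Number System (PMNS) $(p,n,\gamma,\rho)_E$ consists of integers $p,n,\gamma,\rho$ and a monic polynomial $E\in\mathbb{Z}[X]$ of degree $n$ such that $0<\gamma<p$, $E(\gamma)\equiv 0 \pmod p$, and for every integer $x\in\{0,\dots,p-1\}$ there exist integers $x_0,\dots,x_{n-1}$ with $-\rho<x_i<\rho$ for all $i$ and $x\equiv \sum_{i=0}^{n-1}x_i\gamma^i \pmod p$. Here $e_0,\dots,e_{n-1}$ is the standard basis of $\mathbb{Z}^n$. *)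

theory Defs
  imports
    "Jordan_Normal_Form.Matrix"
    "HOL-Computational_Algebra.Polynomial"
    "HOL-Number_Theory.Cong"
begin

definition is_PMNS :: "int \<Rightarrow> nat \<Rightarrow> int \<Rightarrow> int \<Rightarrow> int poly \<Rightarrow> bool" where
  "is_PMNS p n \<gamma> \<rho> E \<longleftrightarrow>
     lead_coeff E = 1 \<and> degree E = n \<and>
     0 < \<gamma> \<and> \<gamma> < p \<and> [poly E \<gamma> = 0] (mod p) \<and>
     (\<forall>x\<in>{0..p - 1}. \<exists>xs :: nat \<Rightarrow> int.
        (\<forall>i<n. - \<rho> < xs i \<and> xs i < \<rho>) \<and> [x = (\<Sum>i<n. xs i * \<gamma> ^ i)] (mod p))"

definition row_comb :: "int mat \<Rightarrow> (nat \<Rightarrow> int) \<Rightarrow> int vec" where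
  "row_comb M c = finsum_vec TYPE(int) (dim_col M) (\<lambda>i. c i \<cdot>\<^sub>v row M i) {..<dim_row M}"

definition row_lattice :: "int mat \<Rightarrow> int vec set" where
  "row_lattice M = range (row_comb M)"

definition rows_form_basis :: "int mat \<Rightarrow> int vec set \<Rightarrow> bool" where
  "rows_form_basis M L \<longleftrightarrow>
     row_lattice M = L \<and>
     (\<forall>c. row_comb M c = 0\<^sub>v (dim_col M) \<longrightarrow> (\<forall>i<dim_row M. c i = 0))"

definition pmns_matrix :: "int \<Rightarrow> nat \<Rightarrow> int \<Rightarrow> int mat" where
  "pmns_matrix p n \<gamma> = mat\<^sub>r n n (\<lambda>i.
     if i = 0 then p \<cdot>\<^sub>v unit_vec n 0
     else (- \<gamma>) \<cdot>\<^sub>v unit_vec n (i - 1) + unit_vec n i)"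

text \<open>Only meaningful for matrices with at least one column, since \<^const>\<open>Max\<close> is
  unspecified on the empty set.\<close>

definition mat_norm_1 :: "int mat \<Rightarrow> int" where
  "mat_norm_1 M = Max ((\<lambda>j. \<Sum>i<dim_row M. \<bar>M $$ (i, j)\<bar>) ` {..<dim_col M})"

end

theory Submission
  imports Defs
begin

text \<open>Since \<open>p e\<^sub>0\<close> lies in the lattice, \<open>p e\<^sub>0 = \<Sum>\<^sub>i d\<^sub>i B\<^sub>i\<close> with integers \<open>d\<^sub>i\<close>, so
  \<open>x e\<^sub>0\<close> has the real coordinates \<open>x d\<^sub>i / p\<close> with respect to \<open>B\<close>. Rounding them to nearest
  integers \<open>c\<^sub>i\<close> (Babai) gives the representative \<open>x e\<^sub>0 - \<Sum>\<^sub>i c\<^sub>i B\<^sub>i\<close>, whose entries are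
  at most half a column sum of \<open>\<bar>B\<bar>\<close>, and whose value at \<open>\<gamma>\<close> is congruent to \<open>x\<close> because
  every lattice vector, read as a polynomial, vanishes at \<open>\<gamma>\<close> modulo \<open>p\<close>.\<close>

lemma index_row_comb:
  assumes "j < dim_col M"
  shows "row_comb M c $ j = (\<Sum>i<dim_row M. c i * M $$ (i, j))"
proof -
  have "row_comb M c $ j = (\<Sum>i<dim_row M. (c i \<cdot>\<^sub>v row M i) $ j)"
    unfolding row_comb_def using assms
    by (subst index_finsum_vec) (auto intro!: carrier_vecI)
  also have "\<dots> = (\<Sum>i<dim_row M. c i * M $$ (i, j))"
    using assms by (intro sum.cong) auto
  finally show ?thesis .
qed

text \<open>Read as polynomials in X, row 0 is the constant \<open>p\<close>, and row
  \<open>i > 0\<close> is X^i - \<gamma> X^(i-1), which has \<gamma> as an exact root.\<close>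

lemma pmns_matrix_row_vanishes_at_gamma:
  assumes "i < n"
  shows "p dvd (\<Sum>j<n. pmns_matrix p n \<gamma> $$ (i, j) * \<gamma> ^ j)"
proof (cases "i = 0")
  case True
  have "(\<Sum>j<n. pmns_matrix p n \<gamma> $$ (i, j) * \<gamma> ^ j) = (\<Sum>j<n. if j = 0 then p else 0)"
    using True assms by (intro sum.cong) (auto simp: pmns_matrix_def)
  also have "\<dots> = p"
    using assms by simp
  finally show ?thesis by simp
next
  case False
  then obtain k where k: "i = Suc k" by (cases i) auto
  have "(\<Sum>j<n. pmns_matrix p n \<gamma> $$ (i, j) * \<gamma> ^ j)
      = (\<Sum>j<n. (if j = k then - \<gamma> * \<gamma> ^ k else 0) + (if j = Suc k then \<gamma> ^ Suc k else 0))"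
    using k assms by (intro sum.cong) (auto simp: pmns_matrix_def)
  also have "\<dots> = 0"
    using k assms by (simp add: sum.distrib)
  finally show ?thesis by simp
qed

lemma pmns_lattice_vanishes_at_gamma:
  assumes "v \<in> row_lattice (pmns_matrix p n \<gamma>)"
  shows "p dvd (\<Sum>j<n. v $ j * \<gamma> ^ j)"
proof -
  let ?A = "pmns_matrix p n \<gamma>"
  have dims: "dim_row ?A = n" "dim_col ?A = n" by (simp_all add: pmns_matrix_def)
  obtain c where c: "v = row_comb ?A c"
    using assms by (auto simp: row_lattice_def)
  have "(\<Sum>j<n. v $ j * \<gamma> ^ j) = (\<Sum>j<n. \<Sum>i<n. c i * (?A $$ (i, j) * \<gamma> ^ j))"
    by (intro sum.cong) (auto simp: c index_row_comb dims sum_distrib_right mult.assoc)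
  also have "\<dots> = (\<Sum>i<n. c i * (\<Sum>j<n. ?A $$ (i, j) * \<gamma> ^ j))"
    by (subst sum.swap) (simp add: sum_distrib_left)
  finally show ?thesis
    by (auto intro!: dvd_sum dvd_mult pmns_matrix_row_vanishes_at_gamma)
qed

lemma row_in_row_lattice:
  assumes "k < dim_row M"
  shows "row M k \<in> row_lattice M"
proof -
  have "row_comb M (\<lambda>i. if i = k then 1 else 0) = row M k"
  proof (rule eq_vecI)
    have "row_comb M c \<in> carrier_vec (dim_col M)" for c
      unfolding row_comb_def by (rule finsum_vec_closed) (auto intro!: carrier_vecI)
    then show "dim_vec (row_comb M (\<lambda>i. if i = k then 1 else 0)) = dim_vec (row M k)"
      by auto
    fix j assume "j < dim_vec (row M k)"
    then have j: "j < dim_col M" by simp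
    have "(\<Sum>i<dim_row M. (if i = k then 1 else 0) * M $$ (i, j))
        = (\<Sum>i<dim_row M. if i = k then M $$ (i, j) else 0)"
      by (intro sum.cong) auto
    also have "\<dots> = M $$ (k, j)" using assms by simp
    finally show "row_comb M (\<lambda>i. if i = k then 1 else 0) $ j = row M k $ j"
      using j assms by (simp add: index_row_comb)
  qed
  then show ?thesis by (metis row_lattice_def rangeI)
qed

lemma nearest_multiple_exists:
  fixes a p :: int
  assumes "p > 0"
  shows "\<exists>c. 2 * \<bar>a - p * c\<bar> \<le> p"
proof -
  \<comment> \<open>This is the floor of a/p + 1/2, written with integer division. The remainder r
    modulo \<open>2 * p\<close> gives 2 (a - p c) = r - p, which lies in [-p, p).\<close>
  let ?c = "(2 * a + p) div (2 * p)"
  have "2 * a + p = 2 * p * ?c + (2 * a + p) mod (2 * p)" by simp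
  moreover have "0 \<le> (2 * a + p) mod (2 * p)" "(2 * a + p) mod (2 * p) < 2 * p"
    using assms by simp_all
  ultimately have "2 * \<bar>a - p * ?c\<bar> \<le> p" by (simp add: abs_if algebra_simps)
  then show ?thesis by blast
qed

lemma column_sum_le_mat_norm_1:
  assumes "j < dim_col M"
  shows "(\<Sum>i<dim_row M. \<bar>M $$ (i, j)\<bar>) \<le> mat_norm_1 M"
  unfolding mat_norm_1_def using assms by (intro Max_ge) auto

theorem theorem2:
  fixes p \<gamma> \<rho> :: int and n :: nat and E :: "int poly" and B :: "int mat"
  assumes "p \<ge> 2" and "n \<ge> 2"
    and "lead_coeff E = 1" and "degree E = n"
    and "0 < \<gamma>" and "\<gamma> < p" and "[poly E \<gamma> = 0] (mod p)"
    and "B \<in> carrier_mat n n"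
    and "rows_form_basis B (row_lattice (pmns_matrix p n \<gamma>))"
    and "real_of_int \<rho> > 1 / 2 * real_of_int (mat_norm_1 B)"
  shows "is_PMNS p n \<gamma> \<rho> E"
proof -
  let ?A = "pmns_matrix p n \<gamma>"
  have dims: "dim_row B = n" "dim_col B = n" using assms(8) by auto
  have lattice: "row_lattice B = row_lattice ?A"
    using assms(9) by (simp add: rows_form_basis_def)
  have norm: "mat_norm_1 B < 2 * \<rho>" using assms(10) by linarith
  \<comment> \<open>Row 0 of \<open>?A\<close> is p e_0; the coefficients \<open>d\<close> obtained
    from it are its coordinates in the basis \<open>B\<close>.\<close>
  have "row ?A 0 \<in> row_lattice B"
    unfolding lattice using assms(2) by (intro row_in_row_lattice) (simp add: pmns_matrix_def)
  then obtain d where d: "row ?A 0 = row_comb B d"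
    by (auto simp: row_lattice_def)
  have d_index: "(\<Sum>i<n. d i * B $$ (i, j)) = (if j = 0 then p else 0)" if "j < n" for j
  proof -
    have "(\<Sum>i<n. d i * B $$ (i, j)) = row ?A 0 $ j"
      using that by (simp add: d index_row_comb dims)
    also have "\<dots> = (if j = 0 then p else 0)"
      using that by (auto simp: pmns_matrix_def)
    finally show ?thesis .
  qed
  have "\<exists>xs. (\<forall>j<n. - \<rho> < xs j \<and> xs j < \<rho>) \<and> [x = (\<Sum>j<n. xs j * \<gamma> ^ j)] (mod p)" for x
  proof -
    have "\<forall>i. \<exists>c. 2 * \<bar>x * d i - p * c\<bar> \<le> p"
      using assms(1) by (intro allI nearest_multiple_exists) simp
    then obtain c where c: "\<And>i. 2 * \<bar>x * d i - p * c i\<bar> \<le> p" by metis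
    define xs where "xs j = (if j = 0 then x else 0) - row_comb B c $ j" for j
    have "\<bar>xs j\<bar> < \<rho>" if j: "j < n" for j
    proof -
      \<comment> \<open>Multiplying by \<open>p\<close> clears the denominators of the coordinates x
        d_i / p, so the whole estimate stays in the integers. By \<open>d_index\<close>, p x e_0
        becomes x times a combination of the rows of \<open>B\<close>, and the coefficients that
        remain are the rounding errors.\<close>
      have "p * xs j = x * (\<Sum>i<n. d i * B $$ (i, j)) - p * (\<Sum>i<n. c i * B $$ (i, j))"
        using j by (simp add: xs_def d_index index_row_comb dims right_diff_distrib)
      also have "\<dots> = (\<Sum>i<n. (x * d i - p * c i) * B $$ (i, j))"
        by (simp add: sum_distrib_left sum_subtractf left_diff_distrib mult.assoc)
      finally have "2 * \<bar>p * xs j\<bar> = 2 * \<bar>\<Sum>i<n. (x * d i - p * c i) * B $$ (i, j)\<bar>"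
        by simp
      also have "\<dots> \<le> 2 * (\<Sum>i<n. \<bar>(x * d i - p * c i) * B $$ (i, j)\<bar>)"
        by (simp add: sum_abs)
      also have "\<dots> = (\<Sum>i<n. (2 * \<bar>x * d i - p * c i\<bar>) * \<bar>B $$ (i, j)\<bar>)"
        by (simp add: sum_distrib_left abs_mult mult.assoc)
      \<comment> \<open>The factor 2 carried along so far is absorbed here: each doubled rounding
        error is at most \<open>p\<close>.\<close>
      also have "\<dots> \<le> (\<Sum>i<n. p * \<bar>B $$ (i, j)\<bar>)"
        by (intro sum_mono mult_right_mono c) simp
      also have "\<dots> = p * (\<Sum>i<n. \<bar>B $$ (i, j)\<bar>)"
        by (simp add: sum_distrib_left)
      also have "\<dots> \<le> p * mat_norm_1 B"
        using column_sum_le_mat_norm_1[of j B] j assms(1) by (simp add: dims)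
      \<comment> \<open>The rounding bound may be attained, so strictness comes from the assumption
        on \<rho>.\<close>
      also have "\<dots> < p * (2 * \<rho>)"
        using norm assms(1) by simp
      finally have "p * \<bar>xs j\<bar> < p * \<rho>"
        using assms(1) by (simp add: abs_mult)
      then show ?thesis using assms(1) by simp
    qed
    moreover have "[x = (\<Sum>j<n. xs j * \<gamma> ^ j)] (mod p)"
    proof -
      have "(\<Sum>j<n. xs j * \<gamma> ^ j)
          = (\<Sum>j<n. (if j = 0 then x else 0) - row_comb B c $ j * \<gamma> ^ j)"
        by (intro sum.cong) (auto simp: xs_def left_diff_distrib)
      also have "\<dots> = x - (\<Sum>j<n. row_comb B c $ j * \<gamma> ^ j)"
        using assms(2) by (simp add: sum_subtractf)
      finally have "x - (\<Sum>j<n. xs j * \<gamma> ^ j) = (\<Sum>j<n. row_comb B c $ j * \<gamma> ^ j)"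
        by simp
      \<comment> \<open>The subtracted vector is a combination of rows of \<open>B\<close>, but
        vanishing at \<gamma> modulo \<open>p\<close> was proved for the rows of \<open>?A\<close>;
        equality of the two lattices bridges the gap.\<close>
      moreover have "row_comb B c \<in> row_lattice ?A"
        unfolding lattice[symmetric] by (simp add: row_lattice_def)
      ultimately show ?thesis
        by (simp add: cong_iff_dvd_diff pmns_lattice_vanishes_at_gamma)
    qed
    ultimately show ?thesis by (intro exI[of _ xs]) (auto simp: abs_less_iff minus_less_iff)
  qed
  then show ?thesis
    using assms(3-7) by (simp add: is_PMNS_def)
qed

end
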